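(* Let $P\ge 2$ be an integer, $\mathbb B=\{1,\dots,P-1\}$, $n\ge 1$, and let $B_1<\cdots<B_n$ be elements of $\mathbb B$ (the true breakpoints). Let $\hat A=\{(a_1,\hat{\mathbf r}_1),\dots,(a_n,\hat{\mathbf r}_n)\}$ be a set of annotations with $a_i=\{1\}$ for every $i$, where $\hat{\mathbf r}_i=[\underline r_i,\overline r_i]\subseteq\mathbb B$ are pairwise disjoint integer intervals such that $B_i\in\hat{\mathbf r}_i$ for every $i\in\{1,\dots,n\}$ (so that $\underline r_1<\cdots<\underline r_n$). Let $\hat A^0$ be the associated set of negative annotations $$\hat A^0=\big\{(\{0\},[1,\underline r_1-1]),\ (\{0\},[\overline r_1+1,\underline r_2-1]),\ \dots,\ (\{0\},[\overline r_{n-1}+1,\underline r_n-1]),\ (\{0\},[\overline r_n+1,P-1])\big\}.$$ Then for every set of breakpoint guesses $G\subseteq\mathbb B$, the incomplete annotation error with respect to $\hat A\cup\hat A^0$ equals the complete annotation error with respect to $\hat A$: $$E_{\text{incomplete}}^{\hat A\cup\hat A^0}(G)=E_{\text{complete}}^{\hat A}(G).$$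
   Context: $P$ is the number of positions in a data series, and $\mathbb B=\{1,\dots,P-1\}$ is the set of positions after which a breakpoint is possible. For integers $u,v$, $[u,v]$ denotes the integer interval $\{u,u+1,\dots,v\}$, which is empty if $u>v$. $|S|$ is the cardinality of a finite set $S$, and $x_+=\max(x,0)$. An annotation is a pair $(a,\mathbf r)$ where $\mathbf r\subseteq\mathbb B$ is an integer interval (the region) and $a\subseteq\{0,1,2,\dots\}$ is a nonempty interval of allowed breakpoint counts in that region. For $G\subseteq\mathbb B$ and an annotation $(a,\mathbf r)$ define the annotation-dependent false positive and false negative counts $$\widehat{\mathrm{FP}}(G,\mathbf r,a)=\big(|G\cap\mathbf r|-\max(a)\big)_+,\qquad \widehat{\mathrm{FN}}(G,\mathbf r,a)=\big(\min(a)-|G\cap\mathbf r|\big)_+ .$$ For a finite set of annotations $A$, the incomplete annotation error of $G$ is $$E^{A}_{\text{incomplete}}(G)=\sum_{(a,\mathbf r)\in A}\widehat{\mathrm{FP}}(G,\mathbf r,a)+\widehat{\mathrm{FN}}(G,\mathbf r,a).$$ For $G\subseteq\mathbb B$, a region $\mathbf r$, and a function $\ell:\mathbb B\to[0,1]$ define $$\mathrm{FN}(G,\mathbf r)=\begin{cases}1&\text{if }G\cap\mathbf r=\emptyset\\0&\text{otherwise,}\end{cases}\qquad \mathrm{FP}(G,\mathbf r)=\begin{cases}0&\text{if }G\cap\mathbf r=\emptyset\\|G\cap\mathbf r|-1&\text{otherwise,}\end{cases}$$ $$I(G,\mathbf r,\ell)=\begin{cases}0&\text{if }G\cap\mathbf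 r=\emptyset\\ \min_{g\in G\cap\mathbf r}\ell(g)&\text{otherwise.}\end{cases}$$ For $\hat A=\{(a_1,\hat{\mathbf r}_1),\dots,(a_n,\hat{\mathbf r}_n)\}$ as in the claim, let $\hat\ell_i(g)=1$ if $g\notin\hat{\mathbf r}_i$ and $\hat\ell_i(g)=0$ if $g\in\hat{\mathbf r}_i$, and let $\cup\hat A=\bigcup_{i=1}^n\hat{\mathbf r}_i$ denote the union of the regions. The complete annotation error of $G$ is $$E^{\hat A}_{\text{complete}}(G)=\big|G\setminus(\cup\hat A)\big|+\sum_{i=1}^{n}\mathrm{FP}(G,\hat{\mathbf r}_i)+\mathrm{FN}(G,\hat{\mathbf r}_i)+I(G,\hat{\mathbf r}_i,\hat\ell_i).$$ *)

theory Defs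
  imports Complex_Main "HOL-Library.Disjoint_Sets"
begin

text \<open>An annotation is a pair \<open>(a, r)\<close> of a set of allowed breakpoint counts and a region.\<close>

type_synonym annotation = "nat set \<times> int set"

definition positions :: "int \<Rightarrow> int set" where
  "positions P = {1..P - 1}"

definition pos_part :: "real \<Rightarrow> real" where
  "pos_part x = max x 0"

text \<open>An interval of counts may be unbounded, in which case \<open>max(a) = \<infinity>\<close> and there are no
  false positives.\<close>

definition FP_hat :: "int set \<Rightarrow> int set \<Rightarrow> nat set \<Rightarrow> real" where
  "FP_hat G r a =
     (if finite a then pos_part (real (card (G \<inter> r)) - real (Max a)) else 0)"

definition FN_hat :: "int set \<Rightarrow> int set \<Rightarrow> nat set \<Rightarrow> real" where
  "FN_hat G r a = pos_part (real (Inf a) - real (card (G \<inter> r)))"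

definition E_incomplete :: "annotation set \<Rightarrow> int set \<Rightarrow> real" where
  "E_incomplete A G = (\<Sum>(a, r)\<in>A. (FP_hat G r a + FN_hat G r a))"

definition FN :: "int set \<Rightarrow> int set \<Rightarrow> real" where
  "FN G r = (if G \<inter> r = {} then 1 else 0)"

definition FP :: "int set \<Rightarrow> int set \<Rightarrow> real" where
  "FP G r = (if G \<inter> r = {} then 0 else real (card (G \<inter> r)) - 1)"

definition imprecision :: "int set \<Rightarrow> int set \<Rightarrow> (int \<Rightarrow> real) \<Rightarrow> real" where
  "imprecision G r l = (if G \<inter> r = {} then 0 else Min (l ` (G \<inter> r)))"

definition zero_one_loss :: "int set \<Rightarrow> int \<Rightarrow> real" where
  "zero_one_loss r g = (if g \<in> r then 0 else 1)"

text \<open>Summing over the set of annotations is the same as summing over the index \<open>i = 1, \<dots>, n\<close>,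
  since annotations with pairwise disjoint nonempty regions are distinct.\<close>

definition E_complete :: "annotation set \<Rightarrow> int set \<Rightarrow> real" where
  "E_complete A G =
     real (card (G - (\<Union>(a, r)\<in>A. r)))
     + (\<Sum>(a, r)\<in>A. (FP G r + FN G r + imprecision G r (zero_one_loss r)))"

definition positive_annotations ::
    "nat \<Rightarrow> (nat \<Rightarrow> int) \<Rightarrow> (nat \<Rightarrow> int) \<Rightarrow> annotation set" where
  "positive_annotations n rl ru = (\<lambda>i. ({1}, {rl i..ru i})) ` {1..n}"

definition negative_annotations ::
    "int \<Rightarrow> nat \<Rightarrow> (nat \<Rightarrow> int) \<Rightarrow> (nat \<Rightarrow> int) \<Rightarrow> annotation set" where
  "negative_annotations P n rl ru =
     {({0}, {1..rl 1 - 1})}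
     \<union> (\<lambda>i. ({0}, {ru i + 1..rl (i + 1) - 1})) ` {1..<n}
     \<union> {({0}, {ru n + 1..P - 1})}"

end

theory Submission
  imports Defs
begin

text \<open>A positive annotation contributes \<open>(k - 1)\<^sub>+ + (1 - k)\<^sub>+\<close> to both errors, where \<open>k\<close> is the
  number of guesses in its region; the zero-one loss vanishes on the region. A negative annotation
  contributes the number of guesses in its gap. The gaps partition the complement of the positive
  regions, so together they contribute the number of guesses outside all positive regions.
  Empty gaps may coincide as annotations, but they contribute nothing.\<close>

lemma error_zero_annotation: "FP_hat G r {0} + FN_hat G r {0} = real (card (G \<inter> r))"
  by (simp add: FP_hat_def FN_hat_def pos_part_def)

lemma imprecision_zero_one_loss:
  assumes "finite G"
  shows "imprecision G r (zero_one_loss r) = 0"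
proof (cases "G \<inter> r = {}")
  case False
  then have "zero_one_loss r ` (G \<inter> r) = {0}"
    by (auto simp: zero_one_loss_def)
  then show ?thesis
    by (simp add: imprecision_def)
qed (simp add: imprecision_def)

lemma error_one_annotation:
  assumes "finite G"
  shows "FP_hat G r {1} + FN_hat G r {1} = FP G r + FN G r + imprecision G r (zero_one_loss r)"
proof (cases "G \<inter> r = {}")
  case False
  then have "card (G \<inter> r) \<ge> 1"
    using assms by (simp add: Suc_le_eq card_gt_0_iff)
  with False show ?thesis
    by (simp add: FP_hat_def FN_hat_def pos_part_def FP_def FN_def
        imprecision_zero_one_loss[OF assms])
qed (simp add: FP_hat_def FN_hat_def pos_part_def FP_def FN_def imprecision_def)

lemma E_incomplete_union_disjoint:
  assumes "finite A" "finite A'" "A \<inter> A' = {}"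
  shows "E_incomplete (A \<union> A') G = E_incomplete A G + E_incomplete A' G"
  unfolding E_incomplete_def using assms by (rule sum.union_disjoint)

lemma E_incomplete_zero_annotations:
  assumes "finite I" "finite G" "disjoint_family_on r I"
  shows "E_incomplete ((\<lambda>i. ({0}, r i)) ` I) G = real (card (G \<inter> (\<Union>i\<in>I. r i)))"
proof -
  have "E_incomplete ((\<lambda>i. ({0}, r i)) ` I) G
      = (\<Sum>(a, s)\<in>(\<lambda>i. ({0::nat}, r i)) ` I. FP_hat G s a + FN_hat G s a)"
    by (simp add: E_incomplete_def)
  also have "\<dots> = (\<Sum>i\<in>I. real (card (G \<inter> r i)))"
  \<comment> \<open>The indexing need not be injective: a region shared by two indices is disjoint
    from itself, hence empty.\<close>
  proof (subst sum.reindex_nontrivial[OF assms(1)])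
    fix i j assume "i \<in> I" "j \<in> I" "i \<noteq> j" "({0::nat}, r i) = ({0}, r j)"
    then have "r i = {}"
      using assms(3) by (auto simp: disjoint_family_on_def)
    then show "(case ({0}, r i) of (a, s) \<Rightarrow> FP_hat G s a + FN_hat G s a) = 0"
      by (simp add: error_zero_annotation)
  qed (simp add: error_zero_annotation)
  also have "\<dots> = real (\<Sum>i\<in>I. card (G \<inter> r i))"
    by simp
  also have "(\<Sum>i\<in>I. card (G \<inter> r i)) = card (\<Union>i\<in>I. G \<inter> r i)"
    using assms by (subst card_UN_disjoint) (auto simp: disjoint_family_on_def)
  finally show ?thesis
    by simp
qed

text \<open>Region \<open>i\<close> is \<open>{lo i..up i}\<close> for \<open>1 \<le> i \<le> n\<close>; the boundary values \<open>up 0\<close> and \<open>lo (n + 1)\<close>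
  stand for empty regions just outside the range, so that gap \<open>i\<close> lies between regions \<open>i\<close> and
  \<open>i + 1\<close> for all \<open>0 \<le> i \<le> n\<close>.\<close>

lemma disjoint_family_on_gaps:
  fixes lo up :: "nat \<Rightarrow> int"
  assumes ne: "\<And>i. 1 \<le> i \<Longrightarrow> i \<le> n \<Longrightarrow> lo i \<le> up i"
    and sep: "\<And>i j. i < j \<Longrightarrow> j \<le> n + 1 \<Longrightarrow> up i < lo j"
  shows "disjoint_family_on (\<lambda>i. {up i + 1..lo (i + 1) - 1}) {0..n}"
proof -
  \<comment> \<open>Gap \<open>i\<close> stays below \<open>lo (i + 1)\<close> and gap
    \<open>j\<close> starts above \<open>up j\<close>, so this puts gap \<open>i\<close> to the left
    of gap \<open>j\<close>.\<close>
  have below: "lo (i + 1) \<le> up j" if "i < j" "j \<le> n" for i j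
  proof (cases "j = i + 1")
    case True
    then show ?thesis using ne[of j] that by simp
  next
    case False
    then have "lo (i + 1) \<le> up (i + 1)" "up (i + 1) < lo j" "lo j \<le> up j"
      using ne[of "i + 1"] sep[of "i + 1" j] ne[of j] that by auto
    then show ?thesis by simp
  qed
  have "{up i + 1..lo (i + 1) - 1} \<inter> {up j + 1..lo (j + 1) - 1} = {}"
    if "i \<le> n" "j \<le> n" "i \<noteq> j" for i j
    using below[of i j] below[of j i] that by (cases "i < j") auto
  then show ?thesis
    by (auto simp: disjoint_family_on_def)
qed

text \<open>Both endpoint sequences are monotone, so every region lies on one side of a given gap.
  Conversely, a point outside all regions lies in the gap after the last region that ends before
  it.\<close>

lemma UN_gaps:
  fixes lo up :: "nat \<Rightarrow> int"
  assumes ne: "\<And>i. 1 \<le> i \<Longrightarrow> i \<le> n \<Longrightarrow> lo i \<le> up i"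
    and sep: "\<And>i j. i < j \<Longrightarrow> j \<le> n + 1 \<Longrightarrow> up i < lo j"
  shows "(\<Union>i\<in>{0..n}. {up i + 1..lo (i + 1) - 1})
       = {up 0 + 1..lo (n + 1) - 1} - (\<Union>i\<in>{1..n}. {lo i..up i})"
proof (intro set_eqI iffI)
  have up_mono: "up i \<le> up j" if "i \<le> j" "j \<le> n" for i j
    using sep[of i j] ne[of j] that by (cases "i = j") auto
  have lo_mono: "lo i \<le> lo j" if "1 \<le> i" "i \<le> j" "j \<le> n + 1" for i j
    using sep[of i j] ne[of i] that by (cases "i = j") auto
  fix x
  assume "x \<in> (\<Union>i\<in>{0..n}. {up i + 1..lo (i + 1) - 1})"
  then obtain i where i: "i \<le> n" "up i < x" "x < lo (i + 1)"
    by auto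
  have "x \<notin> {lo j..up j}" if "1 \<le> j" "j \<le> n" for j
    using up_mono[of j i] lo_mono[of "i + 1" j] i that by (cases "j \<le> i") auto
  then show "x \<in> {up 0 + 1..lo (n + 1) - 1} - (\<Union>i\<in>{1..n}. {lo i..up i})"
    using up_mono[of 0 i] lo_mono[of "i + 1" "n + 1"] i by fastforce
next
  fix x
  assume x: "x \<in> {up 0 + 1..lo (n + 1) - 1} - (\<Union>i\<in>{1..n}. {lo i..up i})"
  \<comment> \<open>The set contains 0, because \<open>x\<close> lies above
    \<open>up 0\<close>.\<close>
  define i where "i = Max {i \<in> {0..n}. up i < x}"
  have "i \<in> {i \<in> {0..n}. up i < x}"
    unfolding i_def using x by (intro Max_in) auto
  then have i: "i \<le> n" "up i < x"
    by auto
  have "x < lo (i + 1)"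
  proof (cases "i = n")
    case False
    \<comment> \<open>By maximality of \<open>i\<close>, region \<open>i + 1\<close> does not end
      before \<open>x\<close>; since it also misses \<open>x\<close>, it starts after
      \<open>x\<close>.\<close>
    have "\<not> up (i + 1) < x"
    proof
      assume "up (i + 1) < x"
      then have "i + 1 \<le> i"
        using False i unfolding i_def by (intro Max_ge) auto
      then show False by simp
    qed
    moreover have "i + 1 \<in> {1..n}"
      using False i(1) by simp
    then have "x \<notin> {lo (i + 1)..up (i + 1)}"
      using x by blast
    ultimately show ?thesis
      by simp
  qed (use x in auto)
  then show "x \<in> (\<Union>i\<in>{0..n}. {up i + 1..lo (i + 1) - 1})"
    using i by (intro UN_I[of i]) auto
qed

text \<open>The boundary values 0 and \<open>P\<close> make the two outer annotations gaps 0 and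
  \<open>n\<close>; as \<open>n \<ge> 1\<close>, the updates leave \<open>rl 1\<close> and
  \<open>ru n\<close> unchanged.\<close>

lemma negative_annotations_eq_gaps:
  assumes "n \<ge> 1"
  shows "negative_annotations P n rl ru
       = (\<lambda>i. ({0}, {(ru(0 := 0)) i + 1..(rl(n + 1 := P)) (i + 1) - 1})) ` {0..n}"
proof -
  have "{0..n} = insert 0 (insert n {1..<n})"
    using assms by auto
  then show ?thesis
    using assms by (auto simp: negative_annotations_def image_iff)
qed

text \<open>If \<open>c \<le> b\<close>, the larger left endpoint would belong to both intervals,
  since \<open>a \<le> x < y \<le> d\<close>.\<close>

lemma disjoint_intervals_separated:
  fixes x y :: "'a :: linorder"
  assumes "x \<in> {a..b}" "y \<in> {c..d}" "x < y" "{a..b} \<inter> {c..d} = {}"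
  shows "b < c"
proof (rule ccontr)
  assume "\<not> b < c"
  then have "max a c \<in> {a..b} \<inter> {c..d}"
    using assms(1-3) by auto
  with assms(4) show False by simp
qed

theorem proposition1:
  fixes P :: int and n :: nat and B rl ru :: "nat \<Rightarrow> int" and G :: "int set"
  assumes "P \<ge> 2" and "n \<ge> 1"
    and "\<forall>i\<in>{1..n}. B i \<in> positions P"
    and "strict_mono_on {1..n} B"
    and "\<forall>i\<in>{1..n}. {rl i..ru i} \<subseteq> positions P"
    and "disjoint_family_on (\<lambda>i. {rl i..ru i}) {1..n}"
    and "\<forall>i\<in>{1..n}. B i \<in> {rl i..ru i}"
    and "G \<subseteq> positions P"
  shows "E_incomplete (positive_annotations n rl ru \<union> negative_annotations P n rl ru) G
       = E_complete (positive_annotations n rl ru) G"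
proof -
  let ?pos = "positive_annotations n rl ru" and ?neg = "negative_annotations P n rl ru"
  define lo where "lo = rl(n + 1 := P)"
  define up where "up = ru(0 := 0)"
  have finG: "finite G"
    using assms(8) finite_subset by (auto simp: positions_def)
  have region: "1 \<le> rl i" "rl i \<le> ru i" "ru i < P" if "1 \<le> i" "i \<le> n" for i
  proof -
    show "rl i \<le> ru i"
      using assms(7) that by force
    moreover have "{rl i..ru i} \<subseteq> {1..P - 1}"
      using assms(5) that by (simp add: positions_def)
    ultimately show "1 \<le> rl i" "ru i < P"
      by auto
  qed
  have ne: "lo i \<le> up i" if "1 \<le> i" "i \<le> n" for i
    using region[of i] that by (simp add: lo_def up_def)
  have sep: "up i < lo j" if "i < j" "j \<le> n + 1" for i j
  proof (cases "i = 0 \<or> j = n + 1")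
    case True
    then show ?thesis
      using region[of i] region[of j] that assms(1) by (auto simp: lo_def up_def)
  next
    case False
    then have ij: "i \<in> {1..n}" "j \<in> {1..n}"
      using that by auto
    \<comment> \<open>The regions inherit the order of the true breakpoints they contain.\<close>
    have "B i < B j"
      using assms(4) ij that(1) by (auto simp: strict_mono_on_def)
    moreover have "{rl i..ru i} \<inter> {rl j..ru j} = {}"
      using disjoint_family_onD[OF assms(6) ij] that(1) by simp
    ultimately have "ru i < rl j"
      by (rule disjoint_intervals_separated[OF
            assms(7)[rule_format, OF ij(1)] assms(7)[rule_format, OF ij(2)]])
    then show ?thesis
      using False by (simp add: lo_def up_def)
  qed
  have neg_eq: "?neg = (\<lambda>i. ({0}, {up i + 1..lo (i + 1) - 1})) ` {0..n}"
    unfolding lo_def up_def by (rule negative_annotations_eq_gaps[OF assms(2)])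
  have "(\<Union>i\<in>{0..n}. {up i + 1..lo (i + 1) - 1})
      = {up 0 + 1..lo (n + 1) - 1} - (\<Union>i\<in>{1..n}. {lo i..up i})"
    by (rule UN_gaps) (erule (1) ne, erule (1) sep)
  \<comment> \<open>Here \<open>up 0 + 1 = 1\<close> and \<open>lo (n + 1) - 1 = P - 1\<close>, so
    the outer range is all of \<open>positions P\<close>.\<close>
  also have "\<dots> = positions P - (\<Union>(a, r)\<in>?pos. r)"
    by (auto simp: positions_def positive_annotations_def lo_def up_def)
  finally have gaps: "G \<inter> (\<Union>i\<in>{0..n}. {up i + 1..lo (i + 1) - 1}) = G - (\<Union>(a, r)\<in>?pos. r)"
    using assms(8) by auto
  have neg: "E_incomplete ?neg G = real (card (G - (\<Union>(a, r)\<in>?pos. r)))"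
    unfolding neg_eq gaps[symmetric]
    by (intro E_incomplete_zero_annotations disjoint_family_on_gaps)
      (simp, fact finG, erule (1) ne, erule (1) sep)
  have pos: "E_incomplete ?pos G
      = (\<Sum>(a, r)\<in>?pos. FP G r + FN G r + imprecision G r (zero_one_loss r))"
    unfolding E_incomplete_def
    by (rule sum.cong) (auto simp: positive_annotations_def error_one_annotation[OF finG, simplified])
  have "E_incomplete (?pos \<union> ?neg) G = E_incomplete ?pos G + E_incomplete ?neg G"
    \<comment> \<open>No annotation is shared, because the count sets \<open>{1}\<close> and
      \<open>{0}\<close> differ.\<close>
    by (rule E_incomplete_union_disjoint) (auto simp: positive_annotations_def neg_eq)
  then show ?thesis
    by (simp add: pos neg E_complete_def)
qed

end
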